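(* Let $M \ge 2$, $N \ge 1$ be integers with $\operatorname{rad}(M) \nmid \operatorname{rad}(N)$ and let $\xi$ be a primitive $M$-th root of unity. For every integer $q\ge 0$ let $(\beta_k^{(q)})_{k\ge 0}$ be defined by $\sum_{k\ge 0}\beta_k^{(q)} z^k = G_q(z)/(1-z)^{q+1}$, where $G_q(z)=\sum_{m=0}^{M^{q+1}-1}\xi^{\mathcal{B}_{M,N}(m)}z^m$. Then: (1) for all $p\ge 0$ and $n\ge 0$, $$\beta_n^{(p+1)} = \sum_{k=0}^{\min(n,\,M^{p+2}-1)} \xi^{\mathcal{B}_{M,N}(k)} \binom{n-k+p+1}{p+1};$$ (2) for all $p \ge 0$ and $0 \le n < M^{p+1}$, $$\xi^{\mathcal{B}_{M,N}(n)} = \sum_{k=0}^{n} (-1)^k \binom{p+1}{k} \beta_{n-k}^{(p)}.$$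
   Context: For integers $M\ge 2$, $N \ge 1$ and $n\ge 0$ with base-$M$ expansion $n=\sum_{i\ge 0} d_i(n) M^i$, $d_i(n)\in\{0,\dots,M-1\}$, the base-shifting map is $\mathcal{B}_{M,N}(n) := \sum_{i\ge 0} d_i(n) N^i$. $\operatorname{rad}(k)$ is the product of the distinct prime factors of $k$. Under the hypothesis $\operatorname{rad}(M)\nmid\operatorname{rad}(N)$, $G_q(z)$ is divisible by $(1-z)^{q+1}$, so $G_q(z)/(1-z)^{q+1}$ is a polynomial and $(\beta_k^{(q)})$ has finite support. The binomial coefficient $\binom{p+1}{k}$ is $0$ for $k>p+1$. *)

theory Defs
  imports
    Complex_Main
    "HOL-Computational_Algebra.Computational_Algebra"
    "HOL-Library.Groups_Big_Fun"
begin

definition rad :: "nat \<Rightarrow> nat" where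
  "rad k = \<Prod>(prime_factors k)"

definition primitive_root_of_unity :: "nat \<Rightarrow> complex \<Rightarrow> bool" where
  "primitive_root_of_unity n x \<longleftrightarrow> n > 0 \<and> x ^ n = 1 \<and> (\<forall>k. 0 < k \<and> k < n \<longrightarrow> x ^ k \<noteq> 1)"

definition digit :: "nat \<Rightarrow> nat \<Rightarrow> nat \<Rightarrow> nat" where
  "digit M i n = n div M ^ i mod M"

text \<open>
  For \<open>M \<ge> 2\<close> only finitely many digits of \<open>n\<close> are nonzero, so \<^const>\<open>Sum_any\<close> is here
  the sum over all \<open>i \<ge> 0\<close>.
\<close>

definition base_shift :: "nat \<Rightarrow> nat \<Rightarrow> nat \<Rightarrow> nat" where
  "base_shift M N n = Sum_any (\<lambda>i. digit M i n * N ^ i)"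

definition G_poly :: "nat \<Rightarrow> nat \<Rightarrow> complex \<Rightarrow> nat \<Rightarrow> complex poly" where
  "G_poly M N \<xi> q = (\<Sum>m = 0..M ^ (q + 1) - 1. monom (\<xi> ^ base_shift M N m) m)"

text \<open>
  The quotient is taken in \<open>\<complex>[[z]]\<close>, where \<open>(1 - z) ^ (q + 1)\<close> is a unit. If that
  power divides \<^const>\<open>G_poly\<close>, this is the polynomial quotient, and \<open>\<beta>\<close> has finite support.
\<close>

definition beta :: "nat \<Rightarrow> nat \<Rightarrow> complex \<Rightarrow> nat \<Rightarrow> nat \<Rightarrow> complex" where
  "beta M N \<xi> q k = fps_nth (fps_of_poly (G_poly M N \<xi> q) / (1 - fps_X) ^ (q + 1)) k"

end

theory Submission
  imports Defs
begin

text \<open>Both identities compare coefficients in G = (1 - z)^(q+1) * B, where B generates the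
  \<beta>'s. The constant term of (1 - z)^(q+1) is 1, so it is a unit of the power series ring.
  Multiplying G by its inverse, whose coefficients are given by
  \<open>fps_nth_inverse_one_minus_X_power\<close>, yields (1) as a Cauchy product; multiplying B by
  the power itself, expanded in \<open>fps_nth_one_minus_X_power\<close>, recovers G and yields
  (2).\<close>

text \<open>A factor 1 - z subtracts the sequence shifted by one place; on signed binomials this is
  Pascal's rule.\<close>

lemma fps_nth_one_minus_X_power:
  "fps_nth ((1 - fps_X) ^ n :: 'a::comm_ring_1 fps) k = (-1) ^ k * of_nat (n choose k)"
proof (induction n arbitrary: k)
  case 0
  show ?case by (cases k) auto
next
  case (Suc n)
  have "fps_nth ((1 - fps_X) ^ Suc n :: 'a fps) k =
      fps_nth ((1 - fps_X) ^ n - fps_X * (1 - fps_X) ^ n) k"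
    by (simp add: algebra_simps)
  also have "\<dots> = (-1) ^ k * of_nat (Suc n choose k)"
    by (cases k) (simp_all add: Suc.IH algebra_simps)
  finally show ?case .
qed

text \<open>Each factor 1/(1 - z) replaces a sequence by its partial sums, so the induction step is
  the hockey-stick identity.\<close>

lemma fps_nth_inverse_one_minus_X_power:
  "fps_nth (inverse ((1 - fps_X) ^ Suc q) :: 'a::field fps) n = of_nat ((n + q) choose q)"
proof (induction q arbitrary: n)
  case 0
  show ?case by (simp add: fps_inverse_one_minus_fps_X)
next
  case (Suc q)
  have "inverse ((1 - fps_X) ^ Suc (Suc q)) =
      inverse ((1 - fps_X) ^ Suc q) * inverse (1 - fps_X :: 'a fps)"
    by (metis fps_inverse_mult power_Suc2)
  \<comment> \<open>Symmetry turns each choose q into choose i, the form that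
    \<open>sum_choose_lower\<close> sums.\<close>
  then have "fps_nth (inverse ((1 - fps_X) ^ Suc (Suc q)) :: 'a fps) n =
      of_nat (\<Sum>i\<le>n. (q + i) choose i)"
    by (simp add: fps_mult_nth Suc.IH fps_inverse_one_minus_fps_X atMost_atLeast0
        binomial_symmetric[of q "_ + q"] add.commute del: power_Suc)
  also have "(\<Sum>i\<le>n. (q + i) choose i) = (n + Suc q) choose Suc q"
    by (simp only: sum_choose_lower) (simp add: binomial_symmetric[of n] add.commute)
  finally show ?case .
qed

lemma coeff_G_poly:
  assumes "M > 0"
  shows "coeff (G_poly M N \<xi> q) k = (if k < M ^ (q + 1) then \<xi> ^ base_shift M N k else 0)"
proof -
  have "M ^ (q + 1) > 0"
    using assms by (rule zero_less_power)
  \<comment> \<open>Positivity matters because the subtraction on naturals is truncated.\<close>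
  then have "j \<le> M ^ (q + 1) - 1 \<longleftrightarrow> j < M ^ (q + 1)" for j
    by linarith
  then have "{0..M ^ (q + 1) - 1} = {..<M ^ (q + 1)}"
    by (simp add: set_eq_iff)
  then show ?thesis
    by (simp add: G_poly_def coeff_sum)
qed

theorem theorem3p5:
  fixes M N :: nat and \<xi> :: complex
  assumes "M \<ge> 2" and "N \<ge> 1"
    and "\<not> rad M dvd rad N"
    and "primitive_root_of_unity M \<xi>"
  shows "(\<forall>p n. beta M N \<xi> (p + 1) n =
            (\<Sum>k = 0..min n (M ^ (p + 2) - 1).
               \<xi> ^ base_shift M N k * of_nat ((n - k + p + 1) choose (p + 1)))) \<and>
         (\<forall>p n. n < M ^ (p + 1) \<longrightarrow>
            \<xi> ^ base_shift M N n =
            (\<Sum>k = 0..n. (-1) ^ k * of_nat ((p + 1) choose k) * beta M N \<xi> p (n - k)))"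
proof (intro conjI allI impI)
  have M: "M > 0" using assms(1) by simp
  have unit: "fps_nth ((1 - fps_X) ^ q :: complex fps) 0 \<noteq> 0" for q
    by simp
  show "beta M N \<xi> (p + 1) n = (\<Sum>k = 0..min n (M ^ (p + 2) - 1).
      \<xi> ^ base_shift M N k * of_nat ((n - k + p + 1) choose (p + 1)))" for p n
  proof -
    define L where "L = M ^ (p + 2)"
    have "L > 0"
      unfolding L_def using M by (rule zero_less_power)
    \<comment> \<open>The exponent is p + 2, written \<open>Suc (p + 1)\<close> so that the inverse
      expansion applies with q = p + 1.\<close>
    have "beta M N \<xi> (p + 1) n = (\<Sum>k = 0..n. coeff (G_poly M N \<xi> (p + 1)) k *
        fps_nth (inverse ((1 - fps_X) ^ Suc (p + 1))) (n - k))"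
      unfolding beta_def fps_divide_unit[OF unit] by (simp add: fps_mult_nth)
    also have "\<dots> = (\<Sum>k = 0..n. (if k < L then \<xi> ^ base_shift M N k else 0) *
        of_nat ((n - k + p + 1) choose (p + 1)))"
      unfolding fps_nth_inverse_one_minus_X_power coeff_G_poly[OF M]
      by (simp add: L_def add.assoc del: power_Suc)
    \<comment> \<open>The terms with k \<ge> L vanish, since G has degree below L.\<close>
    also have "\<dots> = (\<Sum>k = 0..min n (L - 1).
        \<xi> ^ base_shift M N k * of_nat ((n - k + p + 1) choose (p + 1)))"
      using \<open>L > 0\<close> by (intro sum.mono_neutral_cong_right) auto
    finally show ?thesis
      unfolding L_def .
  qed
  show "\<xi> ^ base_shift M N n =
      (\<Sum>k = 0..n. (-1) ^ k * of_nat ((p + 1) choose k) * beta M N \<xi> p (n - k))"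
    if n: "n < M ^ (p + 1)" for p n
  proof -
    let ?G = "fps_of_poly (G_poly M N \<xi> p)" and ?u = "(1 - fps_X) ^ (p + 1) :: complex fps"
    have "?u * (?G / ?u) = ?G"
      unfolding fps_divide_unit[OF unit] using inverse_mult_eq_1'[OF unit, of "p + 1"]
      by (metis mult.left_commute mult.right_neutral)
    \<comment> \<open>The bound on n is what makes this coefficient of G the power of \<xi> and not
      0.\<close>
    then have "\<xi> ^ base_shift M N n = fps_nth (?u * (?G / ?u)) n"
      using n by (simp add: coeff_G_poly[OF M])
    then show ?thesis
      by (simp only: fps_mult_nth fps_nth_one_minus_X_power beta_def)
  qed
qed

end
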